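(* If a ruled surface with lightlike rulings is a translating soliton with respect to $\vec v\in\mathbb{E}_1^3$, then it is a cylindrical surface and the rulings are parallel to $\vec v$.
   Context: $\mathbb{E}_1^3$ is $\mathbb{R}^3$ with coordinates $(x,y,z)$ and metric $\langle\,,\rangle=dx^2+dy^2-dz^2$. A nonzero vector $a$ is spacelike, timelike or lightlike if $\langle a,a\rangle$ is $>0$, $<0$ or $=0$, respectively. A surface is non-degenerate if its induced metric is non-degenerate. For a non-degenerate surface let $N$ be the unit normal vector field, $\epsilon=\langle N,N\rangle\in\{-1,1\}$, and $\sigma$ the second fundamental form, $\nabla^0_UV=\nabla_UV+\sigma(U,V)$, where $\nabla^0$ and $\nabla$ are the Levi-Civita connections of $\mathbb{E}_1^3$ and of the surface. The mean curvature vector is $\vec H=\frac12\,\mathrm{trace}(\sigma)$, and the mean curvature $H$ is defined by $\vec H=HN$. A translating soliton with respect to a vector $\vec v$ is a non-degenerate surface with $2H=\langle N,\vec v\rangle$ at every point. A ruled surface is parametrized by $X(s,t)=\gamma(s)+t\,w(s)$, where $\gamma:I\subset\mathbb{R}\to\mathbb{E}_1^3$ is a regular curve and $w(s)$ is a nowhere vanishing vector field along $\gamma$; the straight lines $t\mapsto X(s,t)$ are the rulings, and they are lightlike if $w(s)$ is lightlike for all $s$. The surface is cylindrical if all its rulings are parallel to a fixed direction.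
   Formalization: That the rulings are parallel to v is claimed only for surfaces not contained in an affine plane: a timelike plane containing the direction v is a translating soliton that can be ruled by lightlike lines not parallel to v. *)

theory Defs
  imports "HOL-Analysis.Analysis"
begin

definition lorentz :: "real^3 \<Rightarrow> real^3 \<Rightarrow> real" where
  "lorentz a b = a$1 * b$1 + a$2 * b$2 - a$3 * b$3"

definition lightlike :: "real^3 \<Rightarrow> bool" where
  "lightlike a \<longleftrightarrow> a \<noteq> 0 \<and> lorentz a a = 0"

text \<open>Linear dependence; in particular the zero vector is parallel to every vector.\<close>

definition parallel :: "real^3 \<Rightarrow> real^3 \<Rightarrow> bool" where
  "parallel a b \<longleftrightarrow> collinear {0, a, b}"

definition partial_s :: "(real \<Rightarrow> real \<Rightarrow> real^3) \<Rightarrow> real \<Rightarrow> real \<Rightarrow> real^3" where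
  "partial_s X s t = vector_derivative (\<lambda>u. X u t) (at s)"

definition partial_t :: "(real \<Rightarrow> real \<Rightarrow> real^3) \<Rightarrow> real \<Rightarrow> real \<Rightarrow> real^3" where
  "partial_t X s t = vector_derivative (\<lambda>u. X s u) (at t)"

definition tangent_plane :: "(real \<Rightarrow> real \<Rightarrow> real^3) \<Rightarrow> real \<Rightarrow> real \<Rightarrow> (real^3) set" where
  "tangent_plane X s t = span {partial_s X s t, partial_t X s t}"

definition nondegenerate_surface ::
    "(real \<Rightarrow> real \<Rightarrow> real^3) \<Rightarrow> (real \<times> real) set \<Rightarrow> bool" where
  "nondegenerate_surface X D \<longleftrightarrow>
     (\<forall>(s, t) \<in> D.
        dim (tangent_plane X s t) = 2 \<and>
        (\<forall>a \<in> tangent_plane X s t. (\<forall>b \<in> tangent_plane X s t. lorentz a b = 0) \<longrightarrow> a = 0))"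

definition unit_normal_field ::
    "(real \<Rightarrow> real \<Rightarrow> real^3) \<Rightarrow> (real \<times> real) set \<Rightarrow> (real \<Rightarrow> real \<Rightarrow> real^3) \<Rightarrow> bool" where
  "unit_normal_field X D N \<longleftrightarrow>
     continuous_on D (\<lambda>(s, t). N s t) \<and>
     (\<forall>(s, t) \<in> D.
        (\<forall>a \<in> tangent_plane X s t. lorentz (N s t) a = 0) \<and>
        lorentz (N s t) (N s t) \<in> {-1, 1})"

text \<open>The normal component in the splitting of the ambient space into the tangent plane and
  its Lorentz-orthogonal complement, which is direct where the surface is non-degenerate.\<close>

definition normal_part ::
    "(real \<Rightarrow> real \<Rightarrow> real^3) \<Rightarrow> real \<Rightarrow> real \<Rightarrow> real^3 \<Rightarrow> real^3" where
  "normal_part X s t u =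
     (THE n. (\<forall>a \<in> tangent_plane X s t. lorentz n a = 0) \<and> u - n \<in> tangent_plane X s t)"

text \<open>The second fundamental form on the coordinate fields.  The ambient connection is flat,
  so the ambient covariant derivative of one coordinate field along another is a second
  partial derivative of \<open>X\<close>; by the Gauss formula the second fundamental form is its normal
  component.\<close>

definition sigma_ss :: "(real \<Rightarrow> real \<Rightarrow> real^3) \<Rightarrow> real \<Rightarrow> real \<Rightarrow> real^3" where
  "sigma_ss X s t = normal_part X s t (partial_s (partial_s X) s t)"

definition sigma_st :: "(real \<Rightarrow> real \<Rightarrow> real^3) \<Rightarrow> real \<Rightarrow> real \<Rightarrow> real^3" where
  "sigma_st X s t = normal_part X s t (partial_s (partial_t X) s t)"

definition sigma_tt :: "(real \<Rightarrow> real \<Rightarrow> real^3) \<Rightarrow> real \<Rightarrow> real \<Rightarrow> real^3" where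
  "sigma_tt X s t = normal_part X s t (partial_t (partial_t X) s t)"

text \<open>Half the trace of the second fundamental form with respect to the induced metric: the
  second fundamental form contracted with the inverse of the Gram matrix with rows
  \<open>(E, F)\<close> and \<open>(F, G)\<close>.\<close>

definition mean_curvature_vector ::
    "(real \<Rightarrow> real \<Rightarrow> real^3) \<Rightarrow> real \<Rightarrow> real \<Rightarrow> real^3" where
  "mean_curvature_vector X s t =
     (let E = lorentz (partial_s X s t) (partial_s X s t);
          F = lorentz (partial_s X s t) (partial_t X s t);
          G = lorentz (partial_t X s t) (partial_t X s t)
      in (1/2) *\<^sub>R ((1 / (E * G - F\<^sup>2)) *\<^sub>R
           (G *\<^sub>R sigma_ss X s t - (2 * F) *\<^sub>R sigma_st X s t + E *\<^sub>R sigma_tt X s t)))"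

definition mean_curvature ::
    "(real \<Rightarrow> real \<Rightarrow> real^3) \<Rightarrow> (real \<Rightarrow> real \<Rightarrow> real^3) \<Rightarrow> real \<Rightarrow> real \<Rightarrow> real" where
  "mean_curvature X N s t = (THE h. mean_curvature_vector X s t = h *\<^sub>R N s t)"

text \<open>The soliton equation is invariant under replacing \<open>N\<close> by \<open>-N\<close>, so it does not depend on
  which unit normal field is used.\<close>

definition translating_soliton ::
    "(real \<Rightarrow> real \<Rightarrow> real^3) \<Rightarrow> (real \<times> real) set \<Rightarrow> real^3 \<Rightarrow> bool" where
  "translating_soliton X D v \<longleftrightarrow>
     nondegenerate_surface X D \<and>
     (\<exists>N. unit_normal_field X D N \<and>
          (\<forall>(s, t) \<in> D. 2 * mean_curvature X N s t = lorentz (N s t) v))"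

definition C2_on :: "(real \<Rightarrow> real^3) \<Rightarrow> real set \<Rightarrow> bool" where
  "C2_on c I \<longleftrightarrow>
     c C1_differentiable_on I \<and> (\<lambda>s. vector_derivative c (at s)) C1_differentiable_on I"

definition ruled_data :: "real set \<Rightarrow> (real \<Rightarrow> real^3) \<Rightarrow> (real \<Rightarrow> real^3) \<Rightarrow> bool" where
  "ruled_data I \<gamma> w \<longleftrightarrow>
     open I \<and> is_interval I \<and> I \<noteq> {} \<and>
     C2_on \<gamma> I \<and> C2_on w I \<and>
     (\<forall>s\<in>I. vector_derivative \<gamma> (at s) \<noteq> 0) \<and> (\<forall>s\<in>I. w s \<noteq> 0)"

definition ruled :: "(real \<Rightarrow> real^3) \<Rightarrow> (real \<Rightarrow> real^3) \<Rightarrow> real \<Rightarrow> real \<Rightarrow> real^3" where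
  "ruled \<gamma> w s t = \<gamma> s + t *\<^sub>R w s"

definition cylindrical :: "real set \<Rightarrow> (real \<Rightarrow> real^3) \<Rightarrow> bool" where
  "cylindrical I w \<longleftrightarrow> (\<exists>d. d \<noteq> 0 \<and> (\<forall>s\<in>I. parallel (w s) d))"

text \<open>The trace of the surface in space, used to single out planar surfaces.  A timelike plane
  containing the direction \<open>v\<close> has zero mean curvature and normal orthogonal to \<open>v\<close>, so it is
  a translating soliton, and it can be ruled by lightlike lines not parallel to \<open>v\<close>.\<close>

definition ruled_image ::
    "real set \<Rightarrow> (real \<Rightarrow> real^3) \<Rightarrow> (real \<Rightarrow> real^3) \<Rightarrow> (real^3) set" where
  "ruled_image I \<gamma> w = (\<lambda>(s, t). ruled \<gamma> w s t) ` (I \<times> UNIV)"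

end

theory Submission
  imports Defs
begin

text \<open>
Write \<open>F\<close> for the Lorentz product of \<open>\<gamma>'\<close> and \<open>w\<close>. Since \<open>w\<close> is lightlike, it is orthogonal to
itself and to \<open>w'\<close>, so the first fundamental form of \<open>\<gamma> + t w\<close> has \<open>G = 0\<close> and off-diagonal
coefficient \<open>F\<close>, which is independent of \<open>t\<close> and, by non-degeneracy, nonzero. The surface is
therefore timelike with spacelike normal, and because the rulings are straight, the only term of
the mean curvature that survives is the mixed one. The soliton equation becomes, for all \<open>t\<close>,

  \<open>2 det(\<gamma>', w, w') = F (det(\<gamma>', w, v) + t det(w', w, v))\<close>,

so both coefficients of this polynomial in \<open>t\<close> can be compared (\<open>ruled_soliton_equation\<close>). In
particular \<open>det(w', w, v) = 0\<close>.

The vectors orthogonal to the lightlike \<open>w\<close> form a plane that contains \<open>w\<close> and on which the metric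
is positive semidefinite with kernel spanned by \<open>w\<close> (\<open>lightlike_orthogonal_cross3\<close>). If \<open>w'\<close>, which
lies in this plane, is not a multiple of \<open>w\<close> at some parameter, then it is spacelike there and
nearby; \<open>w\<close> and \<open>w'\<close> span the plane, and \<open>det(w', w, v) = 0\<close> puts \<open>v\<close> in it. Differentiating
the relation \<open>v \<bottom> w\<close> gives \<open>v \<bottom> w'\<close> as well, so \<open>v\<close> is a multiple of \<open>w\<close>. The remaining
coefficient then yields \<open>det(\<gamma>', w, w') = 0\<close>, that is, \<open>\<gamma>' \<bottom> w\<close>, against \<open>F \<noteq> 0\<close>.

Hence \<open>w'\<close> is everywhere a multiple of \<open>w\<close>, so the direction of \<open>w\<close> is constant and the surface is
cylindrical. What is left of the equation is \<open>det(\<gamma>', w, v) = 0\<close>: if \<open>v\<close> is not parallel to the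
rulings, the velocity of \<open>\<gamma>\<close> stays in the fixed plane of directions spanned by \<open>w\<close> and \<open>v\<close>, and
the surface lies in one plane.
\<close>

section \<open>Lorentzian linear algebra\<close>

lemmas lorentz_coords = lorentz_def cross3_def inner_vec_def sum_3 vector_3

lemma lorentz_commute: "lorentz a b = lorentz b a"
  by (simp add: lorentz_def algebra_simps)

lemma lorentz_add_left: "lorentz (a + b) c = lorentz a c + lorentz b c"
  by (simp add: lorentz_def algebra_simps)

lemma lorentz_diff_left: "lorentz (a - b) c = lorentz a c - lorentz b c"
  by (simp add: lorentz_def algebra_simps)

lemma lorentz_diff_right: "lorentz c (a - b) = lorentz c a - lorentz c b"
  by (simp add: lorentz_def algebra_simps)

lemma lorentz_scaleR_left: "lorentz (r *\<^sub>R a) c = r * lorentz a c"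
  by (simp add: lorentz_def algebra_simps)

lemma lorentz_add_right: "lorentz c (a + b) = lorentz c a + lorentz c b"
  by (simp add: lorentz_def algebra_simps)

lemma lorentz_scaleR_right: "lorentz c (r *\<^sub>R a) = r * lorentz c a"
  by (simp add: lorentz_def algebra_simps)

lemmas lorentz_linear = lorentz_add_left lorentz_diff_left lorentz_scaleR_left
  lorentz_add_right lorentz_diff_right lorentz_scaleR_right

lemma lorentz_has_derivative:
  assumes "(f has_vector_derivative f') (at s)" "(g has_vector_derivative g') (at s)"
  shows "((\<lambda>u. lorentz (f u) (g u)) has_real_derivative
           lorentz f' (g s) + lorentz (f s) g') (at s)"
proof -
  have c: "((\<lambda>u. h u $ i) has_real_derivative h' $ i) (at s)"
    if "(h has_vector_derivative h') (at s)" for h :: "real \<Rightarrow> real^3" and h' i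
    using bounded_linear.has_vector_derivative[OF bounded_linear_vec_nth that]
    by (simp add: has_real_derivative_iff_has_vector_derivative)
  show ?thesis
    unfolding lorentz_def
    by (rule derivative_eq_intros c[OF assms(1)] c[OF assms(2)] refl | simp)+
qed

lemma span_pairE:
  assumes "x \<in> span {a, b}"
  obtains r q where "x = r *\<^sub>R a + q *\<^sub>R b"
proof -
  obtain r where "x - r *\<^sub>R a \<in> span {b}"
    using assms by (auto simp: span_insert)
  then obtain q where "x - r *\<^sub>R a = q *\<^sub>R b"
    by (auto simp: span_singleton)
  then show ?thesis
    using that[of r q] by (simp add: algebra_simps)
qed

lemma lorentz_span:
  assumes "lorentz n a = 0" "lorentz n b = 0" "x \<in> span {a, b}"
  shows "lorentz n x = 0"
proof -
  obtain r q where "x = r *\<^sub>R a + q *\<^sub>R b"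
    using assms(3) by (rule span_pairE)
  then show ?thesis
    using assms(1,2) by (simp add: lorentz_linear)
qed

text \<open>The coordinates of \<open>x\<close> in the basis \<open>a\<close>, \<open>b\<close>, \<open>n = a \<times> b\<close> are read off with the dual basis,
  which up to the factor \<open>n \<bullet> n\<close> consists of \<open>b \<times> n\<close>, \<open>n \<times> a\<close> and \<open>n\<close>.\<close>

lemma mem_span_if_orthogonal_cross3:
  fixes a b x :: "real^3"
  assumes "cross3 a b \<noteq> 0" "cross3 a b \<bullet> x = 0"
  shows "x \<in> span {a, b}"
proof -
  define n where "n = cross3 a b"
  have "(n \<bullet> n) *\<^sub>R x = (cross3 b n \<bullet> x) *\<^sub>R a + (cross3 n a \<bullet> x) *\<^sub>R b + (n \<bullet> x) *\<^sub>R n"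
    unfolding n_def vec_eq_iff forall_3
    by (simp add: lorentz_coords algebra_simps)
  then have "(n \<bullet> n) *\<^sub>R x = (cross3 b n \<bullet> x) *\<^sub>R a + (cross3 n a \<bullet> x) *\<^sub>R b"
    using assms by (simp add: n_def)
  then have "(n \<bullet> n) *\<^sub>R x \<in> span {a, b}"
    by (simp add: span_add span_base span_scale)
  moreover have "n \<bullet> n \<noteq> 0" using assms by (simp add: n_def)
  ultimately show ?thesis
    using span_scale[of "(n \<bullet> n) *\<^sub>R x" "{a, b}" "1 / (n \<bullet> n)"] by simp
qed

text \<open>Reversing the sign of the time coordinate turns the Lorentz product into the Euclidean one, so
  a Lorentz normal of a plane is, up to this reflection and a factor, its Euclidean normal. This
  replaces products with the unit normal of a surface by determinants.\<close>

lemma lorentz_orthogonal_eq_cross3: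
  assumes "cross3 a b \<noteq> 0" "lorentz n a = 0" "lorentz n b = 0"
  shows "\<exists>k. (\<forall>x. lorentz n x = k * (cross3 a b \<bullet> x)) \<and>
             lorentz n n = k\<^sup>2 * lorentz (cross3 a b) (cross3 a b)"
proof -
  define J :: "real^3" where "J = vector [n$1, n$2, - n$3]"
  have J: "lorentz n x = J \<bullet> x" for x
    by (simp add: J_def lorentz_coords)
  have "cross3 (cross3 a b) J = (J \<bullet> a) *\<^sub>R b - (J \<bullet> b) *\<^sub>R a"
    unfolding vec_eq_iff forall_3 by (simp add: lorentz_coords algebra_simps)
  then have "cross3 (cross3 a b) J = 0"
    using assms J by simp
  then have "collinear {0, cross3 a b, J}"
    by (simp add: cross_eq_0)
  then obtain k where k: "J = k *\<^sub>R cross3 a b"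
    using assms(1) by (auto simp: collinear_lemma)
  have "lorentz n n = lorentz J J"
    by (simp add: J_def lorentz_def)
  also have "\<dots> = k\<^sup>2 * lorentz (cross3 a b) (cross3 a b)"
    unfolding k by (simp add: lorentz_linear power2_eq_square)
  finally show ?thesis
    using J k by (intro exI[of _ k]) simp
qed

text \<open>The Lorentzian form of Lagrange's identity: the sign is opposite to the Euclidean one. A normal
  of a plane with \<open>E G - F\<^sup>2 < 0\<close> is therefore spacelike.\<close>

lemma lorentz_cross3_cross3:
  "lorentz (cross3 a b) (cross3 a b) = (lorentz a b)\<^sup>2 - lorentz a a * lorentz b b"
  by (simp add: lorentz_coords power2_eq_square algebra_simps)

lemma lightlike_component3_nonzero:
  assumes "lightlike a"
  shows "a $ 3 \<noteq> 0"
proof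
  assume "a $ 3 = 0"
  with assms have "a $ 1 * a $ 1 + a $ 2 * a $ 2 = 0"
    by (simp add: lightlike_def lorentz_def)
  then have "a $ 1 = 0 \<and> a $ 2 = 0"
    by (simp add: sum_squares_eq_zero_iff)
  with \<open>a $ 3 = 0\<close> assms show False
    by (simp add: lightlike_def vec_eq_iff forall_3)
qed

text \<open>As \<open>a\<close> is Lorentz orthogonal to itself and to \<open>b\<close>, its time reflection is a Euclidean normal
  of both vectors, and \<open>b \<times> a\<close> is a multiple of this reflection. The square of the factor shows
  that a vector orthogonal to \<open>a\<close> is never timelike and is null only when it is proportional to \<open>a\<close>.\<close>

lemma lightlike_orthogonal_cross3:
  assumes "lightlike a" "lorentz a b = 0"
  shows "\<exists>\<mu>. (\<forall>x. cross3 b a \<bullet> x = \<mu> * lorentz a x) \<and> \<mu>\<^sup>2 = lorentz b b"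
proof (intro exI conjI allI)
  have a3: "a$3 \<noteq> 0" using assms(1) by (rule lightlike_component3_nonzero)
  have aa: "a$3 * a$3 = a$1 * a$1 + a$2 * a$2"
    using assms(1) by (simp add: lightlike_def lorentz_def)
  have ab: "a$3 * b$3 = a$1 * b$1 + a$2 * b$2"
    using assms(2) by (simp add: lorentz_def)
  \<comment> \<open>the factor as read off in the time coordinate, where \<open>a\<close> does not vanish\<close>
  let ?m = "(a$1 * b$2 - a$2 * b$1) / a$3"
  have 1: "a$3 * (b$2 * a$3 - b$3 * a$2) = (a$1 * b$2 - a$2 * b$1) * a$1"
    using aa ab by algebra
  have 2: "a$3 * (b$3 * a$1 - b$1 * a$3) = (a$1 * b$2 - a$2 * b$1) * a$2"
    using aa ab by algebra
  have c1: "b$2 * a$3 - b$3 * a$2 = ?m * a$1" and c2: "b$3 * a$1 - b$1 * a$3 = ?m * a$2"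
    using 1 2 a3 by (simp_all add: field_simps)
  have c3: "b$1 * a$2 - b$2 * a$1 = - ?m * a$3"
    using a3 by (simp add: field_simps)
  show "cross3 b a \<bullet> x = ?m * lorentz a x" for x
  proof -
    have l: "m * lorentz a x = m * a$1 * x$1 + m * a$2 * x$2 + (- m * a$3) * x$3" for m
      by (simp add: lorentz_def algebra_simps)
    have "cross3 b a \<bullet> x = (b$2 * a$3 - b$3 * a$2) * x$1 + (b$3 * a$1 - b$1 * a$3) * x$2
            + (b$1 * a$2 - b$2 * a$1) * x$3"
      by (simp add: lorentz_coords)
    then show ?thesis
      unfolding c1 c2 c3 l .
  qed
  have "(a$1 * b$2 - a$2 * b$1)\<^sup>2 = lorentz b b * (a$3)\<^sup>2"
    unfolding lorentz_def using aa ab by algebra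
  then show "?m\<^sup>2 = lorentz b b"
    using a3 by (simp add: power_divide)
qed

lemma lightlike_orthogonal_null:
  assumes "lightlike a" "lorentz a b = 0" "lorentz b b = 0"
  shows "cross3 b a = 0"
proof -
  obtain \<mu> where \<mu>: "\<And>x. cross3 b a \<bullet> x = \<mu> * lorentz a x" "\<mu>\<^sup>2 = lorentz b b"
    using lightlike_orthogonal_cross3[OF assms(1,2)] by blast
  then have "\<mu> = 0" using assms(3) by simp
  then have "cross3 b a \<bullet> cross3 b a = 0" using \<mu>(1) by simp
  then show ?thesis by simp
qed

lemma coplanar_if_translate_span:
  fixes p a b :: "real^3"
  assumes "\<And>x. x \<in> S \<Longrightarrow> x - p \<in> span {a, b}"
  shows "coplanar S"
  unfolding coplanar_def
proof (intro exI subsetI)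
  fix x assume "x \<in> S"
  from assms[OF this] obtain r q where "x - p = r *\<^sub>R a + q *\<^sub>R b"
    by (rule span_pairE)
  then have "x = p + r *\<^sub>R a + q *\<^sub>R b"
    by (metis add.assoc add.commute diff_add_cancel)
  then have "x = (1 - r - q) *\<^sub>R p + r *\<^sub>R (p + a) + q *\<^sub>R (p + b)"
    by (simp add: algebra_simps)
  moreover have "(1 - r - q) + r + q = 1"
    by simp
  ultimately show "x \<in> affine hull {p, p + a, p + b}"
    unfolding affine_hull_3 by (intro CollectI exI conjI)
qed

section \<open>The soliton equation at a point\<close>

text \<open>The normal part of a vector is its orthogonal projection to the unit normal. Two normal parts
  differ by a vector of the tangent plane orthogonal to that plane, which vanishes by
  non-degeneracy; so the definite description denotes this projection.\<close>

lemma normal_part_eq: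
  assumes N: "\<And>x. x \<in> tangent_plane X s t \<Longrightarrow> lorentz N x = 0"
    and e: "lorentz N N = 1"
    and c: "cross3 (partial_s X s t) (partial_t X s t) \<noteq> 0"
    and nd: "\<And>a. \<lbrakk>a \<in> tangent_plane X s t;
               \<And>b. b \<in> tangent_plane X s t \<Longrightarrow> lorentz a b = 0\<rbrakk> \<Longrightarrow> a = 0"
  shows "normal_part X s t u = lorentz u N *\<^sub>R N"
  unfolding normal_part_def
proof (rule the_equality)
  let ?a = "partial_s X s t" and ?b = "partial_t X s t"
  have "lorentz N ?a = 0" "lorentz N ?b = 0"
    by (simp_all add: N tangent_plane_def span_base)
  from lorentz_orthogonal_eq_cross3[OF c this]
  obtain k where k: "\<And>x. lorentz N x = k * (cross3 ?a ?b \<bullet> x)"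
    by blast
  have "k \<noteq> 0"
  proof
    assume "k = 0"
    with k[of N] e show False by simp
  qed
  have "lorentz N (u - lorentz u N *\<^sub>R N) = 0"
    using e by (simp add: lorentz_linear lorentz_commute[of N u])
  then have "cross3 ?a ?b \<bullet> (u - lorentz u N *\<^sub>R N) = 0"
    using k \<open>k \<noteq> 0\<close> by simp
  then have T: "u - lorentz u N *\<^sub>R N \<in> tangent_plane X s t"
    unfolding tangent_plane_def by (rule mem_span_if_orthogonal_cross3[OF c])
  then show "(\<forall>a\<in>tangent_plane X s t. lorentz (lorentz u N *\<^sub>R N) a = 0) \<and>
        u - lorentz u N *\<^sub>R N \<in> tangent_plane X s t"
    using N by (simp add: lorentz_linear)
  fix n assume n: "(\<forall>a\<in>tangent_plane X s t. lorentz n a = 0) \<and> u - n \<in> tangent_plane X s t"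
  have "(u - lorentz u N *\<^sub>R N) - (u - n) \<in> tangent_plane X s t"
    using span_diff[OF T[unfolded tangent_plane_def], of "u - n"] n
    by (simp add: tangent_plane_def)
  then have "n - lorentz u N *\<^sub>R N \<in> tangent_plane X s t"
    by simp
  then have "n - lorentz u N *\<^sub>R N = 0"
    by (rule nd) (use N n in \<open>simp add: lorentz_linear\<close>)
  then show "n = lorentz u N *\<^sub>R N" by simp
qed

text \<open>With \<open>G = 0\<close> and no normal acceleration along the \<open>t\<close>-lines, the trace of the second
  fundamental form reduces to its mixed term, divided by \<open>F\<close>.\<close>

lemma mean_curvature_lightlike_rulings:
  fixes X N s t
  defines "a \<equiv> partial_s X s t" and "b \<equiv> partial_t X s t"
  assumes N: "\<And>x. x \<in> tangent_plane X s t \<Longrightarrow> lorentz (N s t) x = 0"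
    and e: "lorentz (N s t) (N s t) = 1"
    and c: "cross3 a b \<noteq> 0"
    and nd: "\<And>x. \<lbrakk>x \<in> tangent_plane X s t;
               \<And>y. y \<in> tangent_plane X s t \<Longrightarrow> lorentz x y = 0\<rbrakk> \<Longrightarrow> x = 0"
    and G: "lorentz b b = 0" and F: "lorentz a b \<noteq> 0"
    and tt: "partial_t (partial_t X) s t = 0"
  shows "mean_curvature X N s t = lorentz (partial_s (partial_t X) s t) (N s t) / lorentz a b"
proof -
  have np: "normal_part X s t u = lorentz u (N s t) *\<^sub>R N s t" for u
    using c unfolding a_def b_def by (intro normal_part_eq N e nd)
  let ?h = "lorentz (partial_s (partial_t X) s t) (N s t) / lorentz a b"
  have "sigma_tt X s t = 0"
    by (simp add: sigma_tt_def np tt lorentz_def)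
  moreover have "sigma_st X s t = lorentz (partial_s (partial_t X) s t) (N s t) *\<^sub>R N s t"
    by (simp add: sigma_st_def np)
  ultimately have "mean_curvature_vector X s t = ?h *\<^sub>R N s t"
    using G F unfolding mean_curvature_vector_def Let_def a_def b_def
    by (simp add: power2_eq_square field_simps)
  moreover have "N s t \<noteq> 0" using e by (auto simp: lorentz_def)
  ultimately show ?thesis
    unfolding mean_curvature_def by (intro the_equality) auto
qed

text \<open>Both sides of the soliton equation are products with the unit normal, that is, the same
  nonzero multiple of determinants with \<open>X\<^sub>s \<times> X\<^sub>t\<close>. The factor cancels, and what remains is affine in
  \<open>t\<close>; comparing the values at two parameters of one ruling separates the two coefficients.\<close>

lemma ruled_soliton_equation:
  assumes sol: "translating_soliton (ruled \<gamma> w) (I \<times> UNIV) v"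
    and s: "s \<in> I" and null: "lightlike (w s)"
    and g: "(\<gamma> has_vector_derivative g') (at s)"
    and w: "(w has_vector_derivative w') (at s)"
    and perp: "lorentz (w s) w' = 0"
  shows "lorentz g' (w s) \<noteq> 0"
    and "2 * (cross3 g' (w s) \<bullet> w') = lorentz g' (w s) * (cross3 g' (w s) \<bullet> v)"
    and "cross3 w' (w s) \<bullet> v = 0"
proof -
  let ?X = "ruled \<gamma> w" and ?F = "lorentz g' (w s)"
  have Xt_all: "partial_t ?X = (\<lambda>s t. w s)"
    unfolding partial_t_def ruled_def
    by (intro ext vector_derivative_at) (auto intro!: derivative_eq_intros)
  have Xt: "partial_t ?X s t = w s" for t
    by (simp add: Xt_all)
  have Xs: "partial_s ?X s t = g' + t *\<^sub>R w'" for t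
    unfolding partial_s_def ruled_def
    by (intro vector_derivative_at) (auto intro!: derivative_eq_intros g w)
  have Xst: "partial_s (partial_t ?X) s t = w'" for t
    unfolding Xt_all unfolding partial_s_def using w by (simp add: vector_derivative_at)
  have Xtt: "partial_t (partial_t ?X) s t = 0" for t
    unfolding Xt_all unfolding partial_t_def by simp
  have ww: "lorentz (w s) (w s) = 0" using null by (simp add: lightlike_def)
  have FF: "lorentz (g' + t *\<^sub>R w') (w s) = ?F" for t
    using perp by (simp add: lorentz_linear lorentz_commute[of w' "w s"])
  have T: "tangent_plane ?X s t = span {g' + t *\<^sub>R w', w s}" for t
    by (simp add: tangent_plane_def Xs Xt_all)
  obtain N where N: "unit_normal_field ?X (I \<times> UNIV) N"
    and eq: "\<And>t. 2 * mean_curvature ?X N s t = lorentz (N s t) v"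
    and ndg: "nondegenerate_surface ?X (I \<times> UNIV)"
    using sol s unfolding translating_soliton_def by blast
  have nd: "x = 0" if "x \<in> tangent_plane ?X s t"
    "\<And>y. y \<in> tangent_plane ?X s t \<Longrightarrow> lorentz x y = 0" for x t
    using ndg s that unfolding nondegenerate_surface_def by blast
  have N0: "lorentz (N s t) x = 0" if "x \<in> tangent_plane ?X s t" for x t
    using N s that unfolding unit_normal_field_def by blast
  have N1: "lorentz (N s t) (N s t) \<in> {-1, 1}" for t
    using N s unfolding unit_normal_field_def by blast
  \<comment> \<open>otherwise \<open>w s\<close> would be a tangent vector orthogonal to the whole tangent plane\<close>
  show F: "?F \<noteq> 0"
  proof
    assume "?F = 0"
    then have "lorentz (w s) (g' + 0 *\<^sub>R w') = 0"
      using FF[of 0] lorentz_commute by metis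
    then have "w s = 0"
      using ww by (intro nd[of _ 0]) (auto simp: T span_base intro: lorentz_span)
    then show False using null by (simp add: lightlike_def)
  qed
  have main: "2 * (cross3 (g' + t *\<^sub>R w') (w s) \<bullet> w')
      = ?F * (cross3 (g' + t *\<^sub>R w') (w s) \<bullet> v)" for t
  proof -
    let ?c = "cross3 (g' + t *\<^sub>R w') (w s)"
    have cc: "lorentz ?c ?c = ?F\<^sup>2"
      by (simp add: lorentz_cross3_cross3 FF ww)
    then have c: "?c \<noteq> 0" using F by (auto simp: lorentz_def)
    have "lorentz (N s t) (g' + t *\<^sub>R w') = 0" "lorentz (N s t) (w s) = 0"
      by (simp_all add: N0 T span_base)
    from lorentz_orthogonal_eq_cross3[OF c this]
    obtain k where k: "\<And>x. lorentz (N s t) x = k * (?c \<bullet> x)"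
      and k2: "lorentz (N s t) (N s t) = k\<^sup>2 * lorentz ?c ?c"
      by blast
    have "k \<noteq> 0"
    proof
      assume "k = 0"
      with k[of "N s t"] N1[of t] show False by simp
    qed
    \<comment> \<open>this fixes the sign of the squared length of the normal\<close>
    have "lorentz (N s t) (N s t) \<ge> 0" by (simp add: k2 cc)
    then have e: "lorentz (N s t) (N s t) = 1" using N1[of t] by auto
    have "mean_curvature ?X N s t = lorentz (partial_s (partial_t ?X) s t) (N s t) /
        lorentz (partial_s ?X s t) (partial_t ?X s t)"
    proof (rule mean_curvature_lightlike_rulings)
      show "lorentz (N s t) x = 0" if "x \<in> tangent_plane ?X s t" for x
        using that by (rule N0)
      show "x = 0" if "x \<in> tangent_plane ?X s t"
        "\<And>y. y \<in> tangent_plane ?X s t \<Longrightarrow> lorentz x y = 0" for x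
        using that by (rule nd)
    qed (simp_all add: e c Xst Xtt Xs Xt FF ww F)
    then have "mean_curvature ?X N s t = lorentz w' (N s t) / ?F"
      by (simp add: Xst Xs Xt FF)
    then have "lorentz (N s t) w' = ?F * mean_curvature ?X N s t"
      using F by (simp add: lorentz_commute[of w' "N s t"])
    then have "2 * lorentz (N s t) w' = ?F * lorentz (N s t) v"
      by (simp flip: eq)
    then show ?thesis
      using k \<open>k \<noteq> 0\<close> by simp
  qed
  have d: "cross3 (g' + t *\<^sub>R w') (w s) \<bullet> x = cross3 g' (w s) \<bullet> x + t * (cross3 w' (w s) \<bullet> x)" for t x
    by (simp add: cross_add_left cross_mult_left inner_add_left)
  have d': "cross3 w' (w s) \<bullet> w' = 0"
    by (simp add: dot_cross_self)
  show 0: "2 * (cross3 g' (w s) \<bullet> w') = ?F * (cross3 g' (w s) \<bullet> v)"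
    using main[of 0] by simp
  show "cross3 w' (w s) \<bullet> v = 0"
    using main[of 1] 0 F unfolding d d' by (simp add: algebra_simps)
qed

section \<open>The direction of the rulings\<close>

text \<open>Dividing by a coordinate without zeros normalizes \<open>w\<close>, and the quotient rule shows that the
  normalized field has derivative zero. This avoids solving the equation \<open>w' = k w\<close>, for which the
  factor \<open>k\<close> would have to be shown continuous.\<close>

lemma constant_direction_if_derivative_parallel:
  assumes "open I" "is_interval I"
    and w: "\<And>s. s \<in> I \<Longrightarrow> (w has_vector_derivative w' s) (at s)"
    and nz: "\<And>s. s \<in> I \<Longrightarrow> w s $ i \<noteq> 0"
    and par: "\<And>s. s \<in> I \<Longrightarrow> cross3 (w' s) (w s) = 0"
    and st: "s \<in> I" "t \<in> I"
  shows "w s = (w s $ i / w t $ i) *\<^sub>R w t"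
proof -
  let ?f = "\<lambda>s. (1 / w s $ i) *\<^sub>R w s"
  have "(?f has_vector_derivative 0) (at x within I)" if x: "x \<in> I" for x
  proof -
    have ci: "((\<lambda>u. w u $ i) has_real_derivative w' x $ i) (at x)"
      using bounded_linear.has_vector_derivative[OF bounded_linear_vec_nth w[OF x]]
      by (simp add: has_real_derivative_iff_has_vector_derivative)
    have "((\<lambda>u. 1 / w u $ i) has_real_derivative (- w' x $ i / (w x $ i)\<^sup>2)) (at x)"
      using nz[OF x] by (auto intro!: derivative_eq_intros ci simp: power2_eq_square)
    from has_vector_derivative_scaleR[OF this w[OF x]]
    have "(?f has_vector_derivative
        (1 / w x $ i) *\<^sub>R w' x + (- w' x $ i / (w x $ i)\<^sup>2) *\<^sub>R w x) (at x)"
      by simp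
    moreover obtain k where "w' x = k *\<^sub>R w x"
    proof -
      have "collinear {0, w x, w' x}"
        using par[OF x] by (simp add: cross_eq_0 insert_commute)
      moreover have "w x \<noteq> 0" using nz[OF x] by auto
      ultimately show ?thesis using that unfolding collinear_lemma by force
    qed
    ultimately have "(?f has_vector_derivative 0) (at x)"
      using nz[OF x] by (simp add: power2_eq_square)
    then show ?thesis by (rule has_vector_derivative_at_within)
  qed
  then have "(?f has_derivative (\<lambda>h. 0)) (at x within I)" if "x \<in> I" for x
    using that by (simp add: has_vector_derivative_def)
  moreover have "convex I" using assms(2) by (simp add: is_interval_convex)
  ultimately obtain c where c: "\<And>x. x \<in> I \<Longrightarrow> ?f x = c"
    using has_derivative_zero_constant[of I ?f] by blast
  have "w s = w s $ i *\<^sub>R ?f s" using nz st by simp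
  also have "?f s = ?f t" using c st by simp
  finally show ?thesis by simp
qed

theorem theorem4p1:
  fixes I :: "real set" and \<gamma> w :: "real \<Rightarrow> real^3" and v :: "real^3"
  assumes "ruled_data I \<gamma> w"
    and "\<forall>s\<in>I. lightlike (w s)"
    and "translating_soliton (ruled \<gamma> w) (I \<times> UNIV) v"
  shows "cylindrical I w \<and>
         (\<not> coplanar (ruled_image I \<gamma> w) \<longrightarrow> (\<forall>s\<in>I. parallel (w s) v))"
proof -
  define g' where "g' = (\<lambda>s. vector_derivative \<gamma> (at s))"
  define w' where "w' = (\<lambda>s. vector_derivative w (at s))"
  have I: "open I" "is_interval I" "I \<noteq> {}" and C2: "C2_on \<gamma> I" "C2_on w I"
    using assms(1) by (auto simp: ruled_data_def)
  have null: "lightlike (w s)" if "s \<in> I" for s using assms(2) that by blast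
  have D: "(c has_vector_derivative vector_derivative c (at s)) (at s)"
    if "C2_on c I" "s \<in> I" for c s
    using that unfolding C2_on_def C1_differentiable_on_eq
    by (simp add: vector_derivative_works)
  have g: "(\<gamma> has_vector_derivative g' s) (at s)" if "s \<in> I" for s
    using D[OF C2(1) that] by (simp add: g'_def)
  have w: "(w has_vector_derivative w' s) (at s)" if "s \<in> I" for s
    using D[OF C2(2) that] by (simp add: w'_def)
  have perp: "lorentz (w s) (w' s) = 0" if s: "s \<in> I" for s
  proof -
    have "((\<lambda>u. lorentz (w u) (w u)) has_real_derivative 0) (at s)"
      by (rule has_field_derivative_transform_within_open[OF _ I(1) s, of "\<lambda>u. 0"])
        (use null in \<open>auto simp: lightlike_def\<close>)
    from DERIV_unique[OF this lorentz_has_derivative[OF w[OF s] w[OF s]]]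
    show ?thesis by (simp add: lorentz_commute)
  qed
  have F: "lorentz (g' s) (w s) \<noteq> 0"
    and eq0: "2 * (cross3 (g' s) (w s) \<bullet> w' s) = lorentz (g' s) (w s) * (cross3 (g' s) (w s) \<bullet> v)"
    and eqv: "cross3 (w' s) (w s) \<bullet> v = 0" if "s \<in> I" for s
    using ruled_soliton_equation[OF assms(3) that null[OF that] g[OF that] w[OF that] perp[OF that]]
    by simp_all
  have null': "lorentz (w' s) (w' s) = 0" if s: "s \<in> I" for s
  proof (rule ccontr)
    assume ns: "lorentz (w' s) (w' s) \<noteq> 0"
    \<comment> \<open>the orthogonality of \<open>w\<close> and \<open>v\<close> is needed on a neighbourhood, in order to differentiate it\<close>
    have "continuous_on I w'"
      using C2(2) unfolding C2_on_def w'_def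
      by (blast intro: C1_differentiable_imp_continuous_on)
    then have "continuous_on I (\<lambda>u. lorentz (w' u) (w' u))"
      unfolding lorentz_def by (intro continuous_intros)
    then have "open {u \<in> I. lorentz (w' u) (w' u) \<noteq> 0}"
      using continuous_open_preimage[OF _ I(1), of _ "- {0::real}"]
      by (simp add: vimage_def Int_def open_Compl)
    moreover have "lorentz (w u) v = 0" if "u \<in> {u \<in> I. lorentz (w' u) (w' u) \<noteq> 0}" for u
    proof -
      have u: "u \<in> I" "lorentz (w' u) (w' u) \<noteq> 0" using that by auto
      obtain \<mu> where \<mu>: "\<And>x. cross3 (w' u) (w u) \<bullet> x = \<mu> * lorentz (w u) x"
        "\<mu>\<^sup>2 = lorentz (w' u) (w' u)"
        using lightlike_orthogonal_cross3[OF null[OF u(1)] perp[OF u(1)]] by blast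
      have "\<mu> \<noteq> 0" using \<mu>(2) u(2) by (metis zero_power2)
      moreover have "\<mu> * lorentz (w u) v = 0" using eqv[OF u(1)] \<mu>(1)[of v] by simp
      ultimately show ?thesis by simp
    qed
    ultimately have v_deriv: "((\<lambda>u. lorentz (w u) v) has_real_derivative 0) (at s)"
      using s ns has_field_derivative_transform_within_open
        [where S = "{u \<in> I. lorentz (w' u) (w' u) \<noteq> 0}" and f = "\<lambda>u. 0" and f' = 0 and a = s]
      by simp
    from DERIV_unique[OF v_deriv lorentz_has_derivative[OF w[OF s] has_vector_derivative_const]]
    have w'v: "lorentz (w' s) v = 0" by (simp add: lorentz_def)
    obtain \<mu> where \<mu>: "\<And>x. cross3 (w' s) (w s) \<bullet> x = \<mu> * lorentz (w s) x"
      "\<mu>\<^sup>2 = lorentz (w' s) (w' s)"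
      using lightlike_orthogonal_cross3[OF null[OF s] perp[OF s]] by blast
    have gw: "cross3 (w' s) (w s) \<bullet> g' s \<noteq> 0"
      using \<mu> ns F[OF s] lorentz_commute[of "w s"] by auto
    then have "cross3 (w' s) (w s) \<noteq> 0" by auto
    from mem_span_if_orthogonal_cross3[OF this] eqv[OF s]
    have "v \<in> span {w' s, w s}" by blast
    then obtain p q where v: "v = p *\<^sub>R w' s + q *\<^sub>R w s"
      by (rule span_pairE)
    then have "p = 0"
      using w'v ns perp[OF s] by (simp add: lorentz_linear lorentz_commute[of "w' s" "w s"])
    then have "cross3 (g' s) (w s) \<bullet> v = 0"
      by (simp add: v dot_cross_self)
    then have "cross3 (g' s) (w s) \<bullet> w' s = 0"
      using eq0[OF s] by simp
    moreover have "cross3 (w' s) (w s) \<bullet> g' s = - (cross3 (g' s) (w s) \<bullet> w' s)"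
      by (simp add: lorentz_coords algebra_simps)
    ultimately show False using gw by simp
  qed
  have par: "cross3 (w' s) (w s) = 0" if "s \<in> I" for s
    using lightlike_orthogonal_null[OF null perp null'] that by blast
  have dir: "w s = (w s $ 3 / w t $ 3) *\<^sub>R w t" if "s \<in> I" "t \<in> I" for s t
    by (rule constant_direction_if_derivative_parallel[OF I(1,2) w _ par that])
      (auto dest: lightlike_component3_nonzero[OF null])
  obtain s0 where s0: "s0 \<in> I" using I(3) by blast
  have "parallel (w s) (w s0)" if "s \<in> I" for s
    using dir[OF s0 that] unfolding parallel_def collinear_lemma by blast
  moreover have "w s0 \<noteq> 0" using null[OF s0] by (simp add: lightlike_def)
  ultimately have "cylindrical I w" unfolding cylindrical_def by blast
  moreover have "coplanar (ruled_image I \<gamma> w)" if s1: "s1 \<in> I" "\<not> parallel (w s1) v" for s1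
  proof -
    \<comment> \<open>the Euclidean normal of the plane that will contain the surface\<close>
    define n where "n = cross3 (w s1) v"
    have n0: "n \<noteq> 0" using s1(2) by (simp add: n_def parallel_def cross_eq_0)
    have wn: "w s \<bullet> n = 0" if "s \<in> I" for s
      by (subst dir[OF that s1(1)]) (simp add: n_def dot_cross_self)
    have gn: "g' s \<bullet> n = 0" if s: "s \<in> I" for s
    proof -
      have "cross3 (g' s) (w s) \<bullet> v = 0"
      proof -
        have "cross3 (g' s) (w s) \<bullet> w' s = - (cross3 (w' s) (w s) \<bullet> g' s)"
          by (simp add: lorentz_coords algebra_simps)
        then show ?thesis using eq0[OF s] F[OF s] par[OF s] by simp
      qed
      moreover have "cross3 (g' s) (w s) \<bullet> v = g' s \<bullet> cross3 (w s) v"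
        by (simp add: lorentz_coords algebra_simps)
      moreover have "n = (w s1 $ 3 / w s $ 3) *\<^sub>R cross3 (w s) v"
        unfolding n_def by (subst dir[OF s1(1) s]) (simp add: cross_mult_left)
      ultimately show ?thesis by simp
    qed
    have "((\<lambda>s. \<gamma> s \<bullet> n) has_derivative (\<lambda>h. 0)) (at s within I)" if s: "s \<in> I" for s
    proof -
      have "((\<lambda>s. \<gamma> s \<bullet> n) has_vector_derivative g' s \<bullet> n) (at s)"
        using bounded_linear.has_vector_derivative[OF bounded_linear_inner_left g[OF s]] .
      then show ?thesis
        unfolding gn[OF s] has_vector_derivative_def by (simp add: has_derivative_at_withinI)
    qed
    moreover have "convex I" using I(2) by (simp add: is_interval_convex)
    ultimately obtain c where c: "\<And>s. s \<in> I \<Longrightarrow> \<gamma> s \<bullet> n = c"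
      using has_derivative_zero_constant[of I "\<lambda>s. \<gamma> s \<bullet> n"] by blast
    show ?thesis
    proof (rule coplanar_if_translate_span)
      fix x assume "x \<in> ruled_image I \<gamma> w"
      then obtain s t where "s \<in> I" "x = \<gamma> s + t *\<^sub>R w s"
        by (auto simp: ruled_image_def ruled_def)
      then have "n \<bullet> (x - \<gamma> s1) = 0"
        using c[of s] c[OF s1(1)] wn[of s]
        by (simp add: inner_commute[of n] inner_diff_left inner_add_left)
      then show "x - \<gamma> s1 \<in> span {w s1, v}"
        using mem_span_if_orthogonal_cross3 n0 unfolding n_def by blast
    qed
  qed
  ultimately show ?thesis by blast
qed

end
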